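(* Consider the table $\mathbb R^2\times\mathbb R_{\ge0}$ with boundary $H=\mathbb R^2\times\{0\}$ in $\mathbb R^3$ with the standard contact structure $\xi_{\mathrm{std}}$ and metric $g_{\mathrm{std}}$. For $d>0$ and $\phi\in(0,\pi)$, let $\gamma_{d,\phi}:\mathbb R^-\to\mathbb R^3$ be the horizontal lift, parametrised by arclength and ending at $\gamma_{d,\phi}(0)=(d,0,0)$, of the half-line of the plane that ends at $(d,0)$ and makes there angle $\phi$ with the outward radial half-line, i.e. the half-line $s\mapsto(d,0)+s(\cos\phi,\sin\phi)$, $s\ge0$, traversed towards $(d,0)$. Let $L_{d,\phi}$ be the geodesic (parametrised by arclength on $\mathbb R^+$) with which $\gamma_{d,\phi}$ continues after reflecting at $(d,0,0)\in H$; it is the horizontal lift of a circular trajectory of radius $r=\frac{d}{4\sin\phi}$ and center $O=\bigl(\frac{3d}4,-\cot(\phi)\frac d4\bigr)$. Then: (1) For any $\phi$ sufficiently close to $\pi$, $L_{d,\phi}:\mathbb R^+\to\mathbb R^3$ does not intersect $H$ again. That is, it is a half-helix projecting down to the circle of center $O$ and radius $r$; one then writes $\gamma_{d,\phi}:\mathbb R\to\mathbb R^3$ for the entire billiard trajectory. (2) Fix $\phi$ sufficiently close to $\pi$. Then, as $d\to0$, $L_{d,\phi}$ converges in $C^0_{loc}$ to the constant curve at the origin; i.e. the billiard trajectories $\gamma_{d,\phi}$ converge in $C^0_{loc}$ to a curve that is a half-line ending at the origin over $\mathbb R^-$ and the constant curve at the origin over $\mathbb R^+$. (3) "Sufficiently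 close to $\pi$" includes the interval $\phi\in[1.584,\pi)$ (where $1.584\approx0.5042\pi$).
   Context: On $\mathbb R^3$ with cylindrical coordinates $(r,\theta,z)$ let $\alpha=dz-\tfrac12(x\,dy-y\,dx)=dz-\tfrac12r^2d\theta$, $\xi_{\mathrm{std}}=\ker\alpha$, and $g_{\mathrm{std}}=dx^2+dy^2$ restricted to $\xi_{\mathrm{std}}$. Horizontal curves are those tangent to $\xi_{\mathrm{std}}$; they are determined by their projection to the $(x,y)$-plane and an initial height via $\dot z=\frac12r^2\dot\theta$. Write covectors as $\lambda=a\alpha+b\,dx+c\,dy$; the dual norm is $\sqrt{b^2+c^2}$ and $S=\{b^2+c^2=1\}$. Geodesics parametrised by arclength are projections of Hamiltonian orbits of the dual norm in $S$; $a$ (the magnetic momentum) is constant along them, $(b,c)$ is the velocity of the planar projection, which is a circular arc of signed curvature $a$ (counterclockwise if $a>0$, a straight line if $a=0$). A billiard trajectory consists of geodesic segments in the table; at a reflection point $q\in H$ the ingoing and outgoing momenta $\lambda_{\rm in}\neq\lambda_{\rm out}\in S\cap T_q^*\mathbb R^3$ satisfy $\lambda_{\rm in}-\lambda_{\rm out}\in\mathrm{Ann}(T_qH)=\mathbb R\,dz$. In particular $\gamma_{d,\phi}|_{\mathbb R^-}$ has magnetic momentum $0$ and $L_{d,\phi}$ has magnetic momentum $\frac{4\sin\phi}{d}$. *)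

theory Defs
  imports "HOL-Analysis.Analysis"
begin

text \<open>
  Points, tangent vectors and covectors of $\mathbb{R}^3$ are all of type \<open>real ^ 3\<close>: a covector is the
  triple of its coefficients with respect to $dx, dy, dz$, so the pairing of a covector \<open>p\<close> with
  a vector \<open>v\<close> is \<open>p \<bullet> v\<close>.
\<close>

section \<open>The standard contact sub-Riemannian structure\<close>

text \<open>$\alpha = dz - \frac12 (x\,dy - y\,dx)$\<close>

definition contact_form :: "real ^ 3 \<Rightarrow> real ^ 3" where
  "contact_form q = vector [q$2 / 2, - (q$1) / 2, 1]"

definition xi_std :: "real ^ 3 \<Rightarrow> (real ^ 3) set" where
  "xi_std q = {v. contact_form q \<bullet> v = 0}"

text \<open>$dx^2 + dy^2$, only ever evaluated on vectors of \<open>xi_std\<close>.\<close>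

definition g_std :: "real ^ 3 \<Rightarrow> real ^ 3 \<Rightarrow> real" where
  "g_std v w = v$1 * w$1 + v$2 * w$2"

definition dual_norm :: "real ^ 3 \<Rightarrow> real ^ 3 \<Rightarrow> real" where
  "dual_norm q p = (SUP v\<in>{v \<in> xi_std q. g_std v v \<le> 1}. p \<bullet> v)"

lemma dual_norm_coords:
  "dual_norm q (a *\<^sub>R contact_form q + b *\<^sub>R vector [1, 0, 0] + c *\<^sub>R vector [0, 1, 0])
     = sqrt (b\<^sup>2 + c\<^sup>2)"
proof -
  let ?p = "a *\<^sub>R contact_form q + b *\<^sub>R vector [1, 0, 0] + c *\<^sub>R vector [0, 1, 0] :: real ^ 3"
  let ?B = "{v \<in> xi_std q. g_std v v \<le> 1}"
  have pair: "?p \<bullet> v = b * v$1 + c * v$2" if "v \<in> xi_std q" for v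
  proof -
    have "?p \<bullet> v = a * (contact_form q \<bullet> v) + b * v$1 + c * v$2"
      by (simp add: inner_vec_def sum_3 algebra_simps)
    then show ?thesis
      using that by (simp add: xi_std_def)
  qed
  have upper: "?p \<bullet> v \<le> sqrt (b\<^sup>2 + c\<^sup>2)" if "v \<in> ?B" for v
  proof -
    have v1: "(v$1)\<^sup>2 + (v$2)\<^sup>2 \<le> 1"
      using that by (simp add: g_std_def power2_eq_square)
    have "(b * v$1 + c * v$2)\<^sup>2 + (b * v$2 - c * v$1)\<^sup>2 = (b\<^sup>2 + c\<^sup>2) * ((v$1)\<^sup>2 + (v$2)\<^sup>2)"
      by algebra
    also have "\<dots> \<le> b\<^sup>2 + c\<^sup>2"
      using v1 by (intro mult_left_le) auto
    finally have "(b * v$1 + c * v$2)\<^sup>2 \<le> b\<^sup>2 + c\<^sup>2"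
      by (smt (verit) zero_le_power2)
    then show ?thesis
      using pair that by (simp add: real_le_rsqrt)
  qed
  define s where "s = sqrt (b\<^sup>2 + c\<^sup>2)"
  define w :: "real ^ 3" where
    "w = vector [b / s, c / s, (q$1 * (c / s) - q$2 * (b / s)) / 2]"
  have s2: "s\<^sup>2 = b\<^sup>2 + c\<^sup>2"
    by (simp add: s_def)
  have w_xi: "w \<in> xi_std q"
    by (simp add: xi_std_def contact_form_def w_def inner_vec_def sum_3 field_simps)
  have "(b / s)\<^sup>2 + (c / s)\<^sup>2 \<le> 1"
    using s2 by (cases "s = 0") (auto simp: power_divide simp flip: add_divide_distrib)
  then have w_B: "w \<in> ?B"
    using w_xi by (simp add: g_std_def w_def power2_eq_square)
  have "?p \<bullet> w = (b\<^sup>2 + c\<^sup>2) / s"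
    using pair[OF w_xi] by (simp add: w_def power2_eq_square add_divide_distrib)
  also have "\<dots> = s"
    unfolding s2[symmetric] by (simp add: power2_eq_square)
  finally have w_val: "?p \<bullet> w = s" .
  show ?thesis
    unfolding dual_norm_def
    by (rule cSup_eq_maximum) (use upper w_B w_val s_def in \<open>force+\<close>)
qed

definition unit_covectors :: "real ^ 3 \<Rightarrow> (real ^ 3) set" where
  "unit_covectors q = {p. dual_norm q p = 1}"

section \<open>Horizontal curves and geodesics\<close>

definition proj :: "real ^ 3 \<Rightarrow> real ^ 2" where
  "proj q = vector [q$1, q$2]"

definition horizontal_lift :: "real set \<Rightarrow> (real \<Rightarrow> real ^ 2) \<Rightarrow> (real \<Rightarrow> real ^ 3) \<Rightarrow> bool" where
  "horizontal_lift I c \<gamma> \<longleftrightarrow>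
     (\<forall>t\<in>I. proj (\<gamma> t) = c t \<and>
       (\<exists>v\<in>xi_std (\<gamma> t). (\<gamma> has_vector_derivative v) (at t within I)))"

definition arclength_param :: "real set \<Rightarrow> (real \<Rightarrow> real ^ 3) \<Rightarrow> bool" where
  "arclength_param I \<gamma> \<longleftrightarrow>
     (\<forall>t\<in>I. \<exists>v\<in>xi_std (\<gamma> t). (\<gamma> has_vector_derivative v) (at t within I) \<and> g_std v v = 1)"

text \<open>
  Hamilton's equations $\dot q = \partial h/\partial p$, $\dot p = -\partial h/\partial q$, written as
  $dh(u, w) = w \cdot \dot q - u \cdot \dot p$ for variations \<open>u\<close> of $q$ and \<open>w\<close> of $p$.
\<close>

definition hamiltonian_orbit ::
  "(real ^ 3 \<Rightarrow> real ^ 3 \<Rightarrow> real) \<Rightarrow> real set \<Rightarrow> (real \<Rightarrow> real ^ 3) \<Rightarrow> (real \<Rightarrow> real ^ 3) \<Rightarrow> bool" where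
  "hamiltonian_orbit h I q p \<longleftrightarrow>
     (\<forall>t\<in>I. \<exists>q' p'.
        (q has_vector_derivative q') (at t within I) \<and>
        (p has_vector_derivative p') (at t within I) \<and>
        ((\<lambda>(x, y). h x y) has_derivative (\<lambda>(u, w). w \<bullet> q' - u \<bullet> p')) (at (q t, p t)))"

text \<open>\<open>\<gamma>\<close> is an arclength geodesic on \<open>I\<close> with momentum \<open>p\<close>.\<close>

definition geodesic :: "real set \<Rightarrow> (real \<Rightarrow> real ^ 3) \<Rightarrow> (real \<Rightarrow> real ^ 3) \<Rightarrow> bool" where
  "geodesic I \<gamma> p \<longleftrightarrow>
     hamiltonian_orbit dual_norm I \<gamma> p \<and> (\<forall>t\<in>I. p t \<in> unit_covectors (\<gamma> t))"

section \<open>Billiards in the upper half-space\<close>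

definition table :: "(real ^ 3) set" where
  "table = {q. q$3 \<ge> 0}"

definition wall :: "(real ^ 3) set" where
  "wall = {q. q$3 = 0}"

definition wall_tangent :: "(real ^ 3) set" where
  "wall_tangent = {v. v$3 = 0}"

definition annihilator :: "(real ^ 3) set \<Rightarrow> (real ^ 3) set" where
  "annihilator V = {p. \<forall>v\<in>V. p \<bullet> v = 0}"

definition reflection :: "real ^ 3 \<Rightarrow> real ^ 3 \<Rightarrow> real ^ 3 \<Rightarrow> bool" where
  "reflection q p_in p_out \<longleftrightarrow>
     q \<in> wall \<and> p_in \<in> unit_covectors q \<and> p_out \<in> unit_covectors q \<and>
     p_in \<noteq> p_out \<and> p_in - p_out \<in> annihilator wall_tangent"

text \<open>Billiard trajectory on the interval \<open>I\<close> whose set of reflection times is \<open>R\<close>.\<close>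

definition billiard_trajectory :: "real set \<Rightarrow> real set \<Rightarrow> (real \<Rightarrow> real ^ 3) \<Rightarrow> bool" where
  "billiard_trajectory I R \<gamma> \<longleftrightarrow>
     \<gamma> ` I \<subseteq> table \<and>
     R \<subseteq> interior I \<and> (\<forall>a b. finite (R \<inter> {a..b})) \<and>
     (\<forall>J. is_interval J \<and> J \<subseteq> I \<and> interior J \<inter> R = {} \<longrightarrow> (\<exists>p. geodesic J \<gamma> p)) \<and>
     (\<forall>t\<in>R. \<exists>e>0. \<exists>p_in p_out.
        geodesic {t - e..t} \<gamma> p_in \<and> geodesic {t..t + e} \<gamma> p_out \<and>
        reflection (\<gamma> t) (p_in t) (p_out t))"

text \<open>
  \<open>L\<close> is the geodesic on $[0,\infty)$ with which the geodesic \<open>\<gamma>\<close> on $(-\infty,0]$ continues after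
  reflecting at time \<open>0\<close>. Whether \<open>L\<close> stays in the table is not part of this notion.
\<close>

definition continues_after_reflection :: "(real \<Rightarrow> real ^ 3) \<Rightarrow> (real \<Rightarrow> real ^ 3) \<Rightarrow> bool" where
  "continues_after_reflection \<gamma> L \<longleftrightarrow>
     (\<exists>p_in p_out. geodesic {..0} \<gamma> p_in \<and> geodesic {0..} L p_out \<and>
        L 0 = \<gamma> 0 \<and> reflection (\<gamma> 0) (p_in 0) (p_out 0))"

definition join_at_0 :: "(real \<Rightarrow> real ^ 3) \<Rightarrow> (real \<Rightarrow> real ^ 3) \<Rightarrow> real \<Rightarrow> real ^ 3" where
  "join_at_0 \<gamma> L t = (if t < 0 then \<gamma> t else L t)"

section \<open>The trajectories of the statement\<close>

text \<open>
  The half-line $s \mapsto (d,0) + s(\cos\phi,\sin\phi)$, $s \ge 0$, traversed towards $(d,0)$: at time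
  $t \le 0$ the parameter is $s = -t$.
\<close>

definition incoming :: "real \<Rightarrow> real \<Rightarrow> (real \<Rightarrow> real ^ 3) \<Rightarrow> bool" where
  "incoming d \<phi> \<gamma> \<longleftrightarrow>
     horizontal_lift {..0} (\<lambda>t. vector [d, 0] + (- t) *\<^sub>R vector [cos \<phi>, sin \<phi>]) \<gamma> \<and>
     arclength_param {..0} \<gamma> \<and> \<gamma> 0 = vector [d, 0, 0]"

definition radius :: "real \<Rightarrow> real \<Rightarrow> real" where
  "radius d \<phi> = d / (4 * sin \<phi>)"

definition center :: "real \<Rightarrow> real \<Rightarrow> real ^ 2" where
  "center d \<phi> = vector [3 * d / 4, - cot \<phi> * (d / 4)]"

text \<open>Unit-speed counterclockwise circular motion.\<close>

definition circular_path :: "real ^ 2 \<Rightarrow> real \<Rightarrow> real \<Rightarrow> real \<Rightarrow> real ^ 2" where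
  "circular_path c r \<theta> t = c + r *\<^sub>R vector [cos (\<theta> + t / r), sin (\<theta> + t / r)]"

text \<open>Locally uniform convergence on \<open>I\<close>.\<close>

definition C0_loc_limit ::
  "real set \<Rightarrow> (real \<Rightarrow> real \<Rightarrow> real ^ 3) \<Rightarrow> (real \<Rightarrow> real ^ 3) \<Rightarrow> real filter \<Rightarrow> bool" where
  "C0_loc_limit I f l F \<longleftrightarrow> (\<forall>K. compact K \<and> K \<subseteq> I \<longrightarrow> uniform_limit K f l F)"

end

theory Submission
  imports Defs
begin

text \<open>
  In the coordinates $(q, p)$ Hamilton's equations are an explicit ODE whose solutions are unique,
  by an energy estimate for $(b, c)$. The incoming half-line has $a = 0$, and the only other covector
  of $S$ on the line $\lambda_{\rm in} + \mathbb{R}\,dz$ has $a = 4 \sin\phi / d = 1/r$, so the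
  outgoing geodesic is an explicit helix. With $\tau = t/r$ its height is
  $z = \frac{r^2}{2} F(\tau)$, where
  $F(\tau) = \tau - 4 \sin\phi \cos\phi\,(1 - \cos\tau) + (4 \sin^2\phi - 1) \sin\tau$.
  If $\cos\phi \le 0$, the middle term is nonnegative. Then $F(\tau) > \tau - \sin\tau \ge 0$ for
  $\tau \le 3 < \pi$, and $F(\tau) \ge \tau - 3$ for larger $\tau$, because
  $-1 < 4 \sin^2\phi - 1 \le 3$. Hence all $\phi \in [\pi/2, \pi)$ are admissible, and they contain
  $[1.584, \pi)$. All coordinates of the helix are $O(d)$ on compact time intervals.
\<close>

section \<open>Differentiation of curves by components\<close>

lemma has_vector_derivative_vec_iff:
  fixes f :: "real \<Rightarrow> real ^ 'n"
  shows "(f has_vector_derivative v) (at t within S) \<longleftrightarrow>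
     (\<forall>i. ((\<lambda>t. f t $ i) has_real_derivative v $ i) (at t within S))"
  unfolding has_vector_derivative_def has_field_derivative_def
  by (subst has_derivative_componentwise_within)
     (auto simp: Basis_vec_def inner_axis mult_commute_abs)

lemma has_vector_derivative_vec3_iff:
  fixes f :: "real \<Rightarrow> real ^ 3"
  shows "(f has_vector_derivative v) (at t within S) \<longleftrightarrow>
     ((\<lambda>t. f t $ 1) has_real_derivative v $ 1) (at t within S) \<and>
     ((\<lambda>t. f t $ 2) has_real_derivative v $ 2) (at t within S) \<and>
     ((\<lambda>t. f t $ 3) has_real_derivative v $ 3) (at t within S)"
  by (simp add: has_vector_derivative_vec_iff forall_3)

section \<open>Geodesic equations\<close>

text \<open>The coefficients $b$ and $c$ of the covector $p = a\alpha + b\,dx + c\,dy$ at $q$, where $a = p_3$.\<close>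

definition coeff_dx :: "real ^ 3 \<Rightarrow> real ^ 3 \<Rightarrow> real" where
  "coeff_dx q p = p$1 - p$3 * q$2 / 2"

definition coeff_dy :: "real ^ 3 \<Rightarrow> real ^ 3 \<Rightarrow> real" where
  "coeff_dy q p = p$2 + p$3 * q$1 / 2"

lemma dual_norm_eq: "dual_norm q p = sqrt ((coeff_dx q p)\<^sup>2 + (coeff_dy q p)\<^sup>2)"
proof -
  have "p = p$3 *\<^sub>R contact_form q + coeff_dx q p *\<^sub>R vector [1, 0, 0]
      + coeff_dy q p *\<^sub>R vector [0, 1, 0]"
    by (simp add: vec_eq_iff forall_3 contact_form_def coeff_dx_def coeff_dy_def)
  then show ?thesis
    by (metis dual_norm_coords)
qed

lemma unit_covectors_iff:
  "p \<in> unit_covectors q \<longleftrightarrow> (coeff_dx q p)\<^sup>2 + (coeff_dy q p)\<^sup>2 = 1"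
  by (simp add: unit_covectors_def dual_norm_eq)

text \<open>On \<open>S\<close> the value \<open>sqrt (b\<^sup>2 + c\<^sup>2)\<close> is 1, so the
  root is differentiable there and its differential is just b db + c dc. Sorting this by the
  variations \<open>w\<close> of the momentum and \<open>u\<close> of the point gives the two
  vectors.\<close>

lemma dual_norm_has_derivative:
  assumes "p \<in> unit_covectors q"
  defines "b \<equiv> coeff_dx q p" and "c \<equiv> coeff_dy q p"
  shows "((\<lambda>(x, y). dual_norm x y) has_derivative
     (\<lambda>(u, w). w \<bullet> vector [b, c, (q$1 * c - q$2 * b) / 2]
              - u \<bullet> vector [- (p$3 * c) / 2, p$3 * b / 2, 0])) (at (q, p))"
proof -
  have unit: "b\<^sup>2 + c\<^sup>2 = 1"
    using assms unit_covectors_iff by blast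
  have nth: "((\<lambda>z. fst z $ i) has_derivative (\<lambda>z. fst z $ i)) F"
            "((\<lambda>z. snd z $ i) has_derivative (\<lambda>z. snd z $ i)) F"
    for i :: 3 and F :: "((real ^ 3) \<times> (real ^ 3)) filter"
    by (auto intro!: bounded_linear_imp_has_derivative bounded_linear_compose[OF bounded_linear_vec_nth]
        bounded_linear_fst bounded_linear_snd)
  have b': "((\<lambda>z. coeff_dx (fst z) (snd z)) has_derivative
       (\<lambda>z. snd z $ 1 - (p$3 * fst z $ 2 + snd z $ 3 * q$2) / 2)) (at (q, p))"
    unfolding coeff_dx_def by (auto intro!: derivative_eq_intros nth)
  have c': "((\<lambda>z. coeff_dy (fst z) (snd z)) has_derivative
       (\<lambda>z. snd z $ 2 + (p$3 * fst z $ 1 + snd z $ 3 * q$1) / 2)) (at (q, p))"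
    unfolding coeff_dy_def by (auto intro!: derivative_eq_intros nth)
  have "((\<lambda>z. sqrt ((coeff_dx (fst z) (snd z))\<^sup>2 + (coeff_dy (fst z) (snd z))\<^sup>2)) has_derivative
       (\<lambda>z. b * (snd z $ 1 - (p$3 * fst z $ 2 + snd z $ 3 * q$2) / 2)
          + c * (snd z $ 2 + (p$3 * fst z $ 1 + snd z $ 3 * q$1) / 2))) (at (q, p))"
    using unit
    by (auto intro!: derivative_eq_intros b' c' simp flip: b_def c_def)
 (simp add: fun_eq_iff algebra_simps add_divide_distrib diff_divide_distrib)
  moreover have "b * (w $ 1 - (p$3 * u $ 2 + w $ 3 * q$2) / 2) + c * (w $ 2 + (p$3 * u $ 1 + w $ 3 * q$1) / 2)
      = w \<bullet> vector [b, c, (q$1 * c - q$2 * b) / 2] - u \<bullet> vector [- (p$3 * c) / 2, p$3 * b / 2, 0]"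
    for u w :: "real ^ 3"
    by (simp add: inner_vec_def sum_3) (simp add: field_simps)
  ultimately show ?thesis
    by (simp only: dual_norm_eq case_prod_unfold)
qed

text \<open>For \<open>p\<close> in \<open>S\<close>, the derivative of the dual norm in the
  momentum: b X + c Y in the horizontal frame X = (1, 0, -y/2), Y = (0, 1, x/2).\<close>

definition geodesic_velocity :: "real ^ 3 \<Rightarrow> real ^ 3 \<Rightarrow> real ^ 3" where
  "geodesic_velocity q p = vector [coeff_dx q p, coeff_dy q p,
     (q$1 * coeff_dy q p - q$2 * coeff_dx q p) / 2]"

text \<open>For \<open>p\<close> in \<open>S\<close>, minus the derivative of the dual norm in the
  point. The zero entry is the conservation of the magnetic momentum a.\<close>

definition geodesic_force :: "real ^ 3 \<Rightarrow> real ^ 3 \<Rightarrow> real ^ 3" where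
  "geodesic_force q p = vector [- (p$3 * coeff_dy q p) / 2, p$3 * coeff_dx q p / 2, 0]"

text \<open>Derivatives at a point are unique, and setting one of the two variations to 0 isolates
  each of Hamilton's equations.\<close>

lemma dual_norm_derivative_unique:
  assumes "((\<lambda>(x, y). dual_norm x y) has_derivative (\<lambda>(u, w). w \<bullet> q' - u \<bullet> p')) (at (q, p))"
    and "p \<in> unit_covectors q"
  shows "q' = geodesic_velocity q p" "p' = geodesic_force q p"
proof -
  have eq: "w \<bullet> q' - u \<bullet> p' = w \<bullet> geodesic_velocity q p - u \<bullet> geodesic_force q p" for u w
    using fun_cong[OF has_derivative_unique[OF assms(1) dual_norm_has_derivative[OF assms(2)]], of "(u, w)"]
    by (simp add: geodesic_velocity_def geodesic_force_def)
  show "q' = geodesic_velocity q p"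
    by (rule vector_eq_ldot[THEN iffD1]) (use eq[of _ 0] in simp)
  show "p' = geodesic_force q p"
    by (rule vector_eq_ldot[THEN iffD1]) (use eq[of 0] in simp)
qed

lemma geodesic_iff:
  "geodesic I q p \<longleftrightarrow> (\<forall>t\<in>I. p t \<in> unit_covectors (q t) \<and>
     (q has_vector_derivative geodesic_velocity (q t) (p t)) (at t within I) \<and>
     (p has_vector_derivative geodesic_force (q t) (p t)) (at t within I))"
proof -
  have "(\<exists>q' p'. (q has_vector_derivative q') (at t within I) \<and> (p has_vector_derivative p') (at t within I) \<and>
        ((\<lambda>(x, y). dual_norm x y) has_derivative (\<lambda>(u, w). w \<bullet> q' - u \<bullet> p')) (at (q t, p t)))
    \<longleftrightarrow> (q has_vector_derivative geodesic_velocity (q t) (p t)) (at t within I) \<and>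
     (p has_vector_derivative geodesic_force (q t) (p t)) (at t within I)"
    if "p t \<in> unit_covectors (q t)" for t
    using dual_norm_derivative_unique[OF _ that] dual_norm_has_derivative[OF that]
    unfolding geodesic_velocity_def[symmetric] geodesic_force_def[symmetric] by blast
  then show ?thesis
    unfolding geodesic_def hamiltonian_orbit_def by blast
qed

lemma geodesic_subset:
  assumes "geodesic I q p" "J \<subseteq> I"
  shows "geodesic J q p"
  using assms has_vector_derivative_within_subset unfolding geodesic_iff by blast

lemma geodesic_transform:
  assumes "geodesic I q p" "\<And>t. t \<in> I \<Longrightarrow> q' t = q t"
  shows "geodesic I q' p"
  using assms unfolding geodesic_iff by (auto intro: has_vector_derivative_transform)

text \<open>In frame coefficients the momentum equation is a rotation of (b, c) with angular speed a
  = \<open>p t $ 3\<close>. Half of each right-hand side comes from the force, half from the motion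
  of the point inside \<open>coeff_dx\<close> and \<open>coeff_dy\<close>.\<close>

lemma geodesic_derivs:
  assumes "geodesic I q p" "t \<in> I"
  defines "b \<equiv> coeff_dx (q t) (p t)" and "c \<equiv> coeff_dy (q t) (p t)"
  shows "((\<lambda>t. q t $ 1) has_real_derivative b) (at t within I)"
    "((\<lambda>t. q t $ 2) has_real_derivative c) (at t within I)"
    "((\<lambda>t. q t $ 3) has_real_derivative (q t $ 1 * c - q t $ 2 * b) / 2) (at t within I)"
    "((\<lambda>t. p t $ 3) has_real_derivative 0) (at t within I)"
    "((\<lambda>t. coeff_dx (q t) (p t)) has_real_derivative - (p t $ 3 * c)) (at t within I)"
    "((\<lambda>t. coeff_dy (q t) (p t)) has_real_derivative p t $ 3 * b) (at t within I)"
proof -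
  have *: "((\<lambda>t. q t $ 1) has_real_derivative b) (at t within I)"
    "((\<lambda>t. q t $ 2) has_real_derivative c) (at t within I)"
    "((\<lambda>t. q t $ 3) has_real_derivative (q t $ 1 * c - q t $ 2 * b) / 2) (at t within I)"
    "((\<lambda>t. p t $ 1) has_real_derivative - (p t $ 3 * c) / 2) (at t within I)"
    "((\<lambda>t. p t $ 2) has_real_derivative p t $ 3 * b / 2) (at t within I)"
    "((\<lambda>t. p t $ 3) has_real_derivative 0) (at t within I)"
    using assms unfolding geodesic_iff has_vector_derivative_vec3_iff
    by (auto simp: geodesic_velocity_def geodesic_force_def)
  then show "((\<lambda>t. q t $ 1) has_real_derivative b) (at t within I)"
    "((\<lambda>t. q t $ 2) has_real_derivative c) (at t within I)"
    "((\<lambda>t. q t $ 3) has_real_derivative (q t $ 1 * c - q t $ 2 * b) / 2) (at t within I)"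
    "((\<lambda>t. p t $ 3) has_real_derivative 0) (at t within I)"
    by auto
  show "((\<lambda>t. coeff_dx (q t) (p t)) has_real_derivative - (p t $ 3 * c)) (at t within I)"
    unfolding coeff_dx_def by (auto intro!: derivative_eq_intros *)
  show "((\<lambda>t. coeff_dy (q t) (p t)) has_real_derivative p t $ 3 * b) (at t within I)"
    unfolding coeff_dy_def by (auto intro!: derivative_eq_intros *)
qed

section \<open>Uniqueness of geodesics with given initial data\<close>

lemma zero_derivative_imp_eq:
  fixes f :: "real \<Rightarrow> real"
  assumes "convex I" "s \<in> I" "t \<in> I"
    and "\<And>t. t \<in> I \<Longrightarrow> (f has_real_derivative 0) (at t within I)"
  shows "f t = f s"
  using has_field_derivative_zero_constant[OF assms(1,4)] assms(2,3) by auto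

lemma same_derivative_imp_eq:
  fixes f g :: "real \<Rightarrow> real"
  assumes "convex I" "s \<in> I" "t \<in> I" "f s = g s"
    and f: "\<And>t. t \<in> I \<Longrightarrow> (f has_real_derivative f' t) (at t within I)"
    and g: "\<And>t. t \<in> I \<Longrightarrow> (g has_real_derivative f' t) (at t within I)"
  shows "f t = g t"
  using zero_derivative_imp_eq[OF assms(1-3), of "\<lambda>t. f t - g t"] DERIV_diff[OF f g] assms(4) by force

text \<open>The system is triangular: a is constant, (b, c) obeys an equation involving only a, x
  and y are integrals of b and c, and z is an integral of x, y, b, c. The quantities are compared in
  this order.\<close>

lemma geodesic_unique:
  assumes I: "convex I" "s \<in> I" "t \<in> I"
    and geo: "geodesic I q p" "geodesic I q' p'"
    and init: "q s = q' s" "p s = p' s"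
  shows "q t = q' t"
proof -
  define b where "b t = coeff_dx (q t) (p t)" for t
  define c where "c t = coeff_dy (q t) (p t)" for t
  define b' where "b' t = coeff_dx (q' t) (p' t)" for t
  define c' where "c' t = coeff_dy (q' t) (p' t)" for t
  note d = geodesic_derivs[OF geo(1), folded b_def c_def]
  note d' = geodesic_derivs[OF geo(2), folded b'_def c'_def]
  have a: "p t $ 3 = p' t $ 3" if "t \<in> I" for t
    using zero_derivative_imp_eq[OF I(1,2) that d(4)] zero_derivative_imp_eq[OF I(1,2) that d'(4)]
      init by simp
  have bc: "b t = b' t" "c t = c' t" if t: "t \<in> I" for t
  proof -
    \<comment> \<open>Both vectors rotate with the same speed a, hence so does their difference, and
      its length is constant.\<close>
    have "((\<lambda>t. (b t - b' t)\<^sup>2 + (c t - c' t)\<^sup>2) has_real_derivative 0) (at t within I)" if t: "t \<in> I" for t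
      by (auto intro!: derivative_eq_intros d(5,6)[OF t] d'(5,6)[OF t] simp: a[OF t] algebra_simps)
    from zero_derivative_imp_eq[OF I(1,2) t this]
    have "(b t - b' t)\<^sup>2 + (c t - c' t)\<^sup>2 = 0"
      by (simp add: b_def b'_def c_def c'_def init)
    then show "b t = b' t" "c t = c' t"
      by (auto simp: sum_power2_eq_zero_iff)
  qed
  have x: "q t $ 1 = q' t $ 1" if "t \<in> I" for t
    by (rule same_derivative_imp_eq[OF I(1,2) that _ d(1)]) (use d'(1) bc init in auto)
  have y: "q t $ 2 = q' t $ 2" if "t \<in> I" for t
    by (rule same_derivative_imp_eq[OF I(1,2) that _ d(2)]) (use d'(2) bc init in auto)
  have z: "q t $ 3 = q' t $ 3" if "t \<in> I" for t
    by (rule same_derivative_imp_eq[OF I(1,2) that _ d(3)]) (use d'(3) bc x y init in auto)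
  show ?thesis
    using x y z I by (simp add: vec_eq_iff forall_3)
qed

section \<open>Horizontal lifts and their uniqueness\<close>

lemma geodesic_velocity_in_xi_std: "geodesic_velocity q p \<in> xi_std q"
  by (simp add: xi_std_def contact_form_def geodesic_velocity_def inner_vec_def sum_3 field_simps)

lemma geodesic_imp_horizontal_lift:
  assumes "geodesic I q p" "\<And>t. t \<in> I \<Longrightarrow> proj (q t) = c t"
  shows "horizontal_lift I c q"
  using assms geodesic_velocity_in_xi_std unfolding horizontal_lift_def geodesic_iff by blast

lemma geodesic_imp_arclength_param:
  assumes "geodesic I q p"
  shows "arclength_param I q"
  unfolding arclength_param_def
proof
  fix t assume t: "t \<in> I"
  then have "g_std (geodesic_velocity (q t) (p t)) (geodesic_velocity (q t) (p t)) = 1"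
    using assms by (simp add: geodesic_iff unit_covectors_iff g_std_def geodesic_velocity_def power2_eq_square)
  with t show "\<exists>v\<in>xi_std (q t). (q has_vector_derivative v) (at t within I) \<and> g_std v v = 1"
    using assms geodesic_velocity_in_xi_std by (metis geodesic_iff)
qed

lemma real_derivative_unique_within:
  fixes f :: "real \<Rightarrow> real"
  assumes "at t within I \<noteq> bot"
    and "(f has_real_derivative a) (at t within I)" "(f has_real_derivative b) (at t within I)"
  shows "a = b"
  using vector_derivative_unique_within[OF assms(1)] assms(2,3)
  by (simp add: has_real_derivative_iff_has_vector_derivative)

text \<open>Equal projections have equal planar velocities, and the contact condition then fixes the
  vertical velocity. \<open>nontriv\<close> excludes isolated points, where derivatives are not
  unique.\<close>

lemma horizontal_lift_unique:
  assumes I: "convex I" "s \<in> I" "t \<in> I" and nontriv: "\<And>t. t \<in> I \<Longrightarrow> at t within I \<noteq> bot"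
    and lift: "horizontal_lift I c q" "horizontal_lift I c q'" and init: "q s = q' s"
  shows "q t = q' t"
proof -
  have xy: "q t $ 1 = q' t $ 1" "q t $ 2 = q' t $ 2" if "t \<in> I" for t
  proof -
    have "proj (q t) = proj (q' t)"
      using lift that by (simp add: horizontal_lift_def)
    then show "q t $ 1 = q' t $ 1" "q t $ 2 = q' t $ 2"
      by (simp_all add: proj_def vec_eq_iff forall_2)
  qed
  have "((\<lambda>t. q t $ 3 - q' t $ 3) has_real_derivative 0) (at t within I)" if t: "t \<in> I" for t
  proof -
    obtain v v' where v: "v \<in> xi_std (q t)" "(q has_vector_derivative v) (at t within I)"
      and v': "v' \<in> xi_std (q' t)" "(q' has_vector_derivative v') (at t within I)"
      using lift t unfolding horizontal_lift_def by blast
    note d = v(2)[unfolded has_vector_derivative_vec3_iff] v'(2)[unfolded has_vector_derivative_vec3_iff]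
    \<comment> \<open>The first coordinates of \<open>q\<close> and \<open>q'\<close> coincide on
      \<open>I\<close>, so \<open>v' $ 1\<close> is also a derivative of the first coordinate of
      \<open>q\<close>.\<close>
    have "v $ 1 = v' $ 1"
      by (rule real_derivative_unique_within[OF nontriv[OF t] conjunct1[OF d(1)]])
        (rule has_field_derivative_transform_within[OF conjunct1[OF d(2)] zero_less_one t], use xy in auto)
    moreover have "v $ 2 = v' $ 2"
      by (rule real_derivative_unique_within[OF nontriv[OF t] conjunct1[OF conjunct2[OF d(1)]]])
        (rule has_field_derivative_transform_within[OF conjunct1[OF conjunct2[OF d(2)]] zero_less_one t],
         use xy in auto)
    ultimately have "v $ 3 = v' $ 3"
      using v(1) v'(1) xy[OF t] by (simp add: xi_std_def contact_form_def inner_vec_def sum_3)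
    then show ?thesis
      using DERIV_diff[OF conjunct2[OF conjunct2[OF d(1)]] conjunct2[OF conjunct2[OF d(2)]]] by simp
  qed
  from zero_derivative_imp_eq[OF I this] show ?thesis
    using xy I init by (simp add: vec_eq_iff forall_3)
qed

section \<open>The incoming half-line\<close>

text \<open>Along the line (x y' - y x')/2 has the constant value -(d sin \<phi>)/2, so the height
  is linear in time.\<close>

definition line_lift :: "real \<Rightarrow> real \<Rightarrow> real \<Rightarrow> real ^ 3" where
  "line_lift d \<phi> t = vector [d - t * cos \<phi>, - t * sin \<phi>, - (d * sin \<phi> / 2) * t]"

lemma line_lift_0 [simp]: "line_lift d \<phi> 0 = vector [d, 0, 0]"
  by (simp add: line_lift_def)

lemma geodesic_line_lift: "geodesic I (line_lift d \<phi>) (\<lambda>t. vector [- cos \<phi>, - sin \<phi>, 0])"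
  unfolding geodesic_iff unit_covectors_iff has_vector_derivative_vec3_iff
  by (auto simp: coeff_dx_def coeff_dy_def geodesic_velocity_def geodesic_force_def line_lift_def
      algebra_simps intro!: derivative_eq_intros)

lemma at_within_atMost_neq_bot: "(t::real) \<le> a \<Longrightarrow> at t within {..a} \<noteq> bot"
  using at_le[of "{..<t}" "{..a}" t] trivial_limit_at_left_real[of t]
  by (metis atMost_iff bot.extremum_uniqueI lessThan_iff less_imp_le order.trans subsetI)

lemma horizontal_lift_line_lift:
  "horizontal_lift I (\<lambda>t. vector [d, 0] + (- t) *\<^sub>R vector [cos \<phi>, sin \<phi>]) (line_lift d \<phi>)"
  by (rule geodesic_imp_horizontal_lift[OF geodesic_line_lift])
     (simp add: proj_def line_lift_def vec_eq_iff forall_2)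

lemma incoming_iff: "incoming d \<phi> \<gamma> \<longleftrightarrow> (\<forall>t\<le>0. \<gamma> t = line_lift d \<phi> t)"
proof
  assume inc: "incoming d \<phi> \<gamma>"
  have "\<gamma> t = line_lift d \<phi> t" if "t \<le> 0" for t
  proof (rule horizontal_lift_unique)
    show "horizontal_lift {..0} (\<lambda>t. vector [d, 0] + (- t) *\<^sub>R vector [cos \<phi>, sin \<phi>]) \<gamma>"
      and "\<gamma> 0 = line_lift d \<phi> 0"
      using inc by (simp_all add: incoming_def)
    show "horizontal_lift {..0} (\<lambda>t. vector [d, 0] + (- t) *\<^sub>R vector [cos \<phi>, sin \<phi>]) (line_lift d \<phi>)"
      by (rule horizontal_lift_line_lift)
  qed (use that at_within_atMost_neq_bot in auto)
  then show "\<forall>t\<le>0. \<gamma> t = line_lift d \<phi> t"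
    by blast
next
  assume eq: "\<forall>t\<le>0. \<gamma> t = line_lift d \<phi> t"
  have geo: "geodesic {..0} \<gamma> (\<lambda>t. vector [- cos \<phi>, - sin \<phi>, 0])"
    by (rule geodesic_transform[OF geodesic_line_lift]) (use eq in simp)
  have "horizontal_lift {..0} (\<lambda>t. vector [d, 0] + (- t) *\<^sub>R vector [cos \<phi>, sin \<phi>]) \<gamma>"
    by (rule geodesic_imp_horizontal_lift[OF geo])
       (use eq in \<open>simp add: proj_def line_lift_def vec_eq_iff forall_2\<close>)
  then show "incoming d \<phi> \<gamma>"
    using eq geodesic_imp_arclength_param[OF geo] unfolding incoming_def by simp
qed

text \<open>The reflection refers to some momentum along the incoming curve, so the momentum must be
  recovered from the curve. The planar velocity (b, c) is constant and nonzero, which by the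
  rotation law forces a = 0.\<close>

lemma incoming_momentum:
  assumes "incoming d \<phi> \<gamma>" and geo: "geodesic {..0} \<gamma> p"
  shows "p 0 = vector [- cos \<phi>, - sin \<phi>, 0]"
proof -
  define b where "b t = coeff_dx (\<gamma> t) (p t)" for t
  define c where "c t = coeff_dy (\<gamma> t) (p t)" for t
  have eq: "\<gamma> t = line_lift d \<phi> t" if "t \<le> 0" for t
    using assms that by (simp add: incoming_iff)
  note der = geodesic_derivs[OF geo, folded b_def c_def]
  have b: "b t = - cos \<phi>" and c: "c t = - sin \<phi>" if "t \<le> 0" for t
  proof -
    have t: "t \<in> {..0}" using that by simp
    have "((\<lambda>t. line_lift d \<phi> t $ 1) has_real_derivative - cos \<phi>) (at t within {..0})"
         "((\<lambda>t. line_lift d \<phi> t $ 2) has_real_derivative - sin \<phi>) (at t within {..0})"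
      by (auto simp: line_lift_def intro!: derivative_eq_intros)
    then have "((\<lambda>t. \<gamma> t $ 1) has_real_derivative - cos \<phi>) (at t within {..0})"
         "((\<lambda>t. \<gamma> t $ 2) has_real_derivative - sin \<phi>) (at t within {..0})"
      using eq that by (auto elim!: has_field_derivative_transform_within[OF _ zero_less_one])
    then show "b t = - cos \<phi>" "c t = - sin \<phi>"
      using der(1,2)[OF t] real_derivative_unique_within[OF at_within_atMost_neq_bot[OF that]] by blast+
  qed
  \<comment> \<open>Values at times \<le> 0 suffice, since the derivative at 0 is taken within the
    half-line.\<close>
  have "(b has_real_derivative 0) (at 0 within {..0})" "(c has_real_derivative 0) (at 0 within {..0})"
    by (rule has_field_derivative_transform_within[OF DERIV_const zero_less_one]; simp add: b c)+
  then have "- (p 0 $ 3 * c 0) = 0" "p 0 $ 3 * b 0 = 0"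
    using der(5,6)[of 0] real_derivative_unique_within[OF at_within_atMost_neq_bot[of 0 0]]
    by blast+
  then have "p 0 $ 3 = 0"
    using b[of 0] c[of 0] sin_zero_norm_cos_one[of \<phi>] by auto
  then show ?thesis
    using b[of 0] c[of 0] eq[of 0]
    by (simp add: b_def c_def coeff_dx_def coeff_dy_def vec_eq_iff forall_3)
qed

section \<open>The outgoing helix\<close>

text \<open>The condition on p_in - p_out fixes the first two coordinates. The unit condition is
  then quadratic in \<open>p $ 3\<close>, with roots 0 and 4 sin \<phi> / d; the root 0 is the
  incoming covector itself, which a reflection excludes.\<close>

lemma reflection_iff:
  assumes "d > 0" "sin \<phi> > 0"
  shows "reflection (vector [d, 0, 0]) (vector [- cos \<phi>, - sin \<phi>, 0]) p \<longleftrightarrow>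
     p = vector [- cos \<phi>, - sin \<phi>, 1 / radius d \<phi>]"
proof -
  have ann: "v - w \<in> annihilator wall_tangent \<longleftrightarrow> w $ 1 = v $ 1 \<and> w $ 2 = v $ 2" for v w
  proof
    assume vw: "v - w \<in> annihilator wall_tangent"
    have "(v - w) \<bullet> vector [1, 0, 0] = 0" "(v - w) \<bullet> vector [0, 1, 0] = 0"
      by (rule vw[unfolded annihilator_def, THEN CollectD, THEN bspec]; simp add: wall_tangent_def)+
    then show "w $ 1 = v $ 1 \<and> w $ 2 = v $ 2"
      by (simp add: inner_vec_def sum_3)
  qed (auto simp: annihilator_def wall_tangent_def inner_vec_def sum_3)
  \<comment> \<open>The left-hand side is the squared dual norm at (d, 0, 0) of a covector with
    first two coordinates -cos \<phi>, -sin \<phi>.\<close>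
  have eq: "(cos \<phi>)\<^sup>2 + (p $ 3 * d / 2 - sin \<phi>)\<^sup>2 = 1 + p $ 3 * (p $ 3 * d - 4 * sin \<phi>) * (d / 4)"
    by (simp add: cos_squared_eq power2_eq_square algebra_simps)
  have "p $ 3 * (p $ 3 * d - 4 * sin \<phi>) * (d / 4) = 0 \<longleftrightarrow> p $ 3 = 0 \<or> p $ 3 = 1 / radius d \<phi>"
    using assms by (auto simp: radius_def field_simps)
  then have "(cos \<phi>)\<^sup>2 + (p $ 3 * d / 2 - sin \<phi>)\<^sup>2 = 1 \<longleftrightarrow> p $ 3 = 0 \<or> p $ 3 = 1 / radius d \<phi>"
    by (simp only: eq add_cancel_left_right)
  moreover have "reflection (vector [d, 0, 0]) (vector [- cos \<phi>, - sin \<phi>, 0]) p \<longleftrightarrow>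
      p $ 1 = - cos \<phi> \<and> p $ 2 = - sin \<phi> \<and> p $ 3 \<noteq> 0 \<and> (cos \<phi>)\<^sup>2 + (p $ 3 * d / 2 - sin \<phi>)\<^sup>2 = 1"
    unfolding reflection_def ann unit_covectors_iff
    by (auto simp: wall_def coeff_dx_def coeff_dy_def vec_eq_iff forall_3)
  moreover have "1 / radius d \<phi> \<noteq> 0"
    using assms by (simp add: radius_def)
  ultimately show ?thesis
    by (auto simp: vec_eq_iff forall_3)
qed

text \<open>The initial angle pi/2 - \<phi> points from the center to (d, 0), because r (sin \<phi>,
  cos \<phi>) = (d/4) (1, cot \<phi>). The height is the integral of (x y' - y x')/2 that vanishes
  at time 0.\<close>

definition helix :: "real \<Rightarrow> real \<Rightarrow> real \<Rightarrow> real ^ 3" where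
  "helix d \<phi> t = (let X = center d \<phi> $ 1; Y = center d \<phi> $ 2; r = radius d \<phi>; \<psi> = pi / 2 - \<phi> + t / r
     in vector [X + r * cos \<psi>, Y + r * sin \<psi>,
          r / 2 * (t + X * (sin \<psi> - cos \<phi>) - Y * (cos \<psi> - sin \<phi>))])"

text \<open>The covector with a = 1/r, b = -sin \<psi>, c = cos \<psi>; the terms with
  \<open>helix\<close> convert (b, c) to the coefficients of dx and dy.\<close>

definition helix_momentum :: "real \<Rightarrow> real \<Rightarrow> real \<Rightarrow> real ^ 3" where
  "helix_momentum d \<phi> t = (let r = radius d \<phi>; \<psi> = pi / 2 - \<phi> + t / r
     in vector [- sin \<psi> + helix d \<phi> t $ 2 / (2 * r), cos \<psi> - helix d \<phi> t $ 1 / (2 * r), 1 / r])"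

lemma helix_0:
  assumes "sin \<phi> \<noteq> 0"
  shows "helix d \<phi> 0 = vector [d, 0, 0]"
proof -
  have "cos (pi / 2 - \<phi>) = sin \<phi>" "sin (pi / 2 - \<phi>) = cos \<phi>"
    by (simp_all add: cos_diff sin_diff)
  then show ?thesis
    using assms
    by (simp add: helix_def Let_def center_def radius_def cot_def vec_eq_iff forall_3)
qed

lemma helix_momentum_0:
  assumes "d \<noteq> 0" "sin \<phi> \<noteq> 0"
  shows "helix_momentum d \<phi> 0 = vector [- cos \<phi>, - sin \<phi>, 1 / radius d \<phi>]"
proof -
  have "cos (pi / 2 - \<phi>) = sin \<phi>" "sin (pi / 2 - \<phi>) = cos \<phi>"
    by (simp_all add: cos_diff sin_diff)
  then show ?thesis
    using assms
    by (simp add: helix_momentum_def helix_0 Let_def radius_def vec_eq_iff forall_3)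
qed

lemma proj_helix: "proj (helix d \<phi> t) = circular_path (center d \<phi>) (radius d \<phi>) (pi / 2 - \<phi>) t"
  by (simp add: proj_def helix_def Let_def circular_path_def vec_eq_iff forall_2)

lemma geodesic_helix:
  assumes "radius d \<phi> \<noteq> 0"
  shows "geodesic I (helix d \<phi>) (helix_momentum d \<phi>)"
proof -
  have dx: "coeff_dx (helix d \<phi> t) (helix_momentum d \<phi> t) = - sin (pi / 2 - \<phi> + t / radius d \<phi>)"
   and dy: "coeff_dy (helix d \<phi> t) (helix_momentum d \<phi> t) = cos (pi / 2 - \<phi> + t / radius d \<phi>)" for t
    by (simp_all add: coeff_dx_def coeff_dy_def helix_momentum_def Let_def)
  have "(helix d \<phi> has_vector_derivative geodesic_velocity (helix d \<phi> t) (helix_momentum d \<phi> t)) (at t within I)" for t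
  proof -
    define X Y r \<psi> where "X = center d \<phi> $ 1" and "Y = center d \<phi> $ 2" and "r = radius d \<phi>"
      and "\<psi> t = pi / 2 - \<phi> + t / r" for t
    have h: "helix d \<phi> t = vector [X + r * cos (\<psi> t), Y + r * sin (\<psi> t),
          r / 2 * (t + X * (sin (\<psi> t) - cos \<phi>) - Y * (cos (\<psi> t) - sin \<phi>))]" for t
      by (simp add: helix_def Let_def X_def Y_def r_def \<psi>_def)
    have r: "r \<noteq> 0"
      using assms by (simp add: r_def)
    have \<psi>': "(\<psi> has_real_derivative 1 / r) (at t within I)"
      unfolding \<psi>_def[abs_def] using r by (auto intro!: derivative_eq_intros)
    \<comment> \<open>Writing 1 as the sum of the squares of cosine and sine turns the derivative of
      the height into (x c - y b)/2.\<close>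
    have "r / 2 * (1 + X * (cos (\<psi> t) / r) + Y * (sin (\<psi> t) / r))
        = (X * cos (\<psi> t) + Y * sin (\<psi> t) + r * ((cos (\<psi> t))\<^sup>2 + (sin (\<psi> t))\<^sup>2)) / 2"
      unfolding sin_cos_squared_add2 using r by (simp add: field_simps)
    also have "\<dots> = ((X + r * cos (\<psi> t)) * cos (\<psi> t) + (Y + r * sin (\<psi> t)) * sin (\<psi> t)) / 2"
      by (simp only: power2_eq_square) (simp only: distrib_left distrib_right mult.assoc add_ac)
    finally have z: "r / 2 * (1 + X * (cos (\<psi> t) / r) + Y * (sin (\<psi> t) / r))
      = ((X + r * cos (\<psi> t)) * cos (\<psi> t) + (Y + r * sin (\<psi> t)) * sin (\<psi> t)) / 2" .
    show ?thesis
      unfolding has_vector_derivative_vec3_iff geodesic_velocity_def dx dy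
      unfolding h r_def[symmetric] \<psi>_def[symmetric] vector_3
      using r z by (auto intro!: derivative_eq_intros \<psi>' simp: mult.commute)
  qed
  moreover have "(helix_momentum d \<phi> has_vector_derivative geodesic_force (helix d \<phi> t) (helix_momentum d \<phi> t)) (at t within I)" for t
    using assms unfolding has_vector_derivative_vec3_iff geodesic_force_def dx dy
    by (auto simp: helix_momentum_def helix_def Let_def field_simps intro!: derivative_eq_intros)
  ultimately show ?thesis
    by (auto simp: geodesic_iff unit_covectors_iff dx dy)
qed

text \<open>The initial point and the outgoing momentum at time 0 are both forced, and they
  determine the geodesic for all later times.\<close>

lemma continues_after_reflection_iff:
  assumes d: "d > 0" "sin \<phi> > 0" and inc: "incoming d \<phi> \<gamma>"
  shows "continues_after_reflection \<gamma> L \<longleftrightarrow> (\<forall>t\<ge>0. L t = helix d \<phi> t)"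
proof
  have \<gamma>0: "\<gamma> 0 = vector [d, 0, 0]" and r: "radius d \<phi> \<noteq> 0"
    using inc d by (auto simp: incoming_def radius_def)
  note h0 = helix_0[of \<phi> d] helix_momentum_0[of d \<phi>]
  show "\<forall>t\<ge>0. L t = helix d \<phi> t" if cont: "continues_after_reflection \<gamma> L"
  proof -
    obtain p p' where geo: "geodesic {..0} \<gamma> p" "geodesic {0..} L p'" and "L 0 = \<gamma> 0"
      and refl: "reflection (\<gamma> 0) (p 0) (p' 0)"
      using cont unfolding continues_after_reflection_def by blast
    then have "L 0 = helix d \<phi> 0" "p' 0 = helix_momentum d \<phi> 0"
      using d h0 \<gamma>0 reflection_iff[OF d] incoming_momentum[OF inc geo(1)] by auto
    then show ?thesis
      using geodesic_unique[OF _ _ _ geo(2) geodesic_helix[OF r], of 0] by auto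
  qed
  show "continues_after_reflection \<gamma> L" if eq: "\<forall>t\<ge>0. L t = helix d \<phi> t"
    unfolding continues_after_reflection_def
  proof (intro exI conjI)
    show "geodesic {..0} \<gamma> (\<lambda>t. vector [- cos \<phi>, - sin \<phi>, 0])"
      using inc by (intro geodesic_transform[OF geodesic_line_lift]) (auto simp: incoming_iff)
    show "geodesic {0..} L (helix_momentum d \<phi>)"
      using eq by (intro geodesic_transform[OF geodesic_helix[OF r]]) auto
    show "L 0 = \<gamma> 0"
      using eq h0 d \<gamma>0 by simp
    show "reflection (\<gamma> 0) (vector [- cos \<phi>, - sin \<phi>, 0]) (helix_momentum d \<phi> 0)"
      using reflection_iff[OF d] h0 d \<gamma>0 by simp
  qed
qed

lemma circular_path_image:
  assumes "r > 0"
  shows "circular_path c r \<theta> ` {0..} = sphere c r"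
proof (intro equalityI subsetI)
  fix x assume "x \<in> circular_path c r \<theta> ` {0..}"
  moreover have "(r * cos a)\<^sup>2 + (r * sin a)\<^sup>2 = r\<^sup>2" for a
    by (simp add: power_mult_distrib flip: distrib_left)
  ultimately show "x \<in> sphere c r"
    using assms by (auto simp: circular_path_def dist_norm norm_vec_def L2_set_def sum_2)
next
  fix x assume "x \<in> sphere c r"
  then have "(x $ 1 - c $ 1)\<^sup>2 + (x $ 2 - c $ 2)\<^sup>2 = r\<^sup>2"
    by (auto simp: dist_norm norm_vec_def L2_set_def sum_2 power2_commute real_sqrt_pow2_iff)
  then have "((x $ 1 - c $ 1) / r)\<^sup>2 + ((x $ 2 - c $ 2) / r)\<^sup>2 = 1"
    using assms by (simp add: power_divide flip: add_divide_distrib)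
  then obtain \<alpha> where \<alpha>: "0 \<le> \<alpha>" "(x $ 1 - c $ 1) / r = cos \<alpha>" "(x $ 2 - c $ 2) / r = sin \<alpha>"
    by (metis sincos_total_2pi)
  \<comment> \<open>Adding n full turns raises the angle by 2 n pi \<ge> n \<ge> \<theta>, so it is
    attained at a nonnegative time.\<close>
  obtain n :: nat where n: "\<theta> \<le> real n"
    using real_arch_simple by blast
  also have "real n \<le> 2 * real n * pi"
    using mult_left_mono[of 1 "2 * pi" "real n"] pi_gt3 by simp
  finally have "0 \<le> r * (\<alpha> + 2 * real n * pi - \<theta>)"
    using assms \<alpha>(1) by simp
  moreover have "x = circular_path c r \<theta> (r * (\<alpha> + 2 * real n * pi - \<theta>))"
  proof -
    have "\<theta> + r * (\<alpha> + 2 * real n * pi - \<theta>) / r = \<alpha> + 2 * real n * pi"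
      using assms by simp
    moreover have "x $ 1 = c $ 1 + r * cos \<alpha>" "x $ 2 = c $ 2 + r * sin \<alpha>"
      using assms \<alpha>(2,3) by (simp_all add: field_simps)
    ultimately show ?thesis
      unfolding circular_path_def by (simp add: vec_eq_iff forall_2 cos_add sin_add)
  qed
  ultimately show "x \<in> circular_path c r \<theta> ` {0..}"
    by auto
qed

text \<open>In units of r^2/2 the height depends only on the turning angle \<open>\<tau>\<close> and
  on \<phi>, so its sign is the same for every d.\<close>

lemma helix_height_pos:
  assumes "d > 0" "sin \<phi> > 0" "cos \<phi> \<le> 0" "t > 0"
  shows "helix d \<phi> t $ 3 > 0"
proof -
  define r where "r = radius d \<phi>"
  define \<tau> where "\<tau> = t / r"
  have r: "r > 0" and d: "d = 4 * r * sin \<phi>"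
    using assms by (auto simp: r_def radius_def)
  have \<tau>: "\<tau> > 0" "t = r * \<tau>"
    using r assms by (auto simp: \<tau>_def)
  \<comment> \<open>The coefficients come from the center, which is r (3 sin \<phi>, -cos
    \<phi>).\<close>
  define F where "F = \<tau> + 4 * sin \<phi> * (- cos \<phi>) * (1 - cos \<tau>) + (3 * (sin \<phi>)\<^sup>2 - (cos \<phi>)\<^sup>2) * sin \<tau>"
  have \<psi>: "sin (pi / 2 - \<phi> + \<tau>) = cos \<phi> * cos \<tau> + sin \<phi> * sin \<tau>"
      "cos (pi / 2 - \<phi> + \<tau>) = sin \<phi> * cos \<tau> - cos \<phi> * sin \<tau>"
    by (simp_all add: sin_add cos_add sin_diff cos_diff)
  have center: "center d \<phi> $ 1 = 3 * r * sin \<phi>" "center d \<phi> $ 2 = - (r * cos \<phi>)"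
    using assms by (simp_all add: center_def d cot_def)
  have eq: "helix d \<phi> t $ 3 = r\<^sup>2 / 2 * F"
    by (simp add: helix_def Let_def center F_def \<psi> flip: r_def \<tau>_def)
       (simp add: \<tau>(2) power2_eq_square algebra_simps)
  have "F > 0"
  proof -
    have "0 \<le> 4 * sin \<phi> * (- cos \<phi>) * (1 - cos \<tau>)"
      using assms by (intro mult_nonneg_nonneg) auto
    then have F: "F \<ge> \<tau> + (4 * (sin \<phi>)\<^sup>2 - 1) * sin \<tau>"
      unfolding F_def cos_squared_eq by (simp add: algebra_simps)
    \<comment> \<open>The threshold 3 serves twice: it lies below pi, so the sine is positive up to
      it, and it bounds the modulus of the sine term beyond it.\<close>
    show ?thesis
    proof (cases "\<tau> \<le> 3")
      case True
      then have "sin \<tau> > 0"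
        using \<tau> pi_gt3 by (intro sin_gt_zero) auto
      \<comment> \<open>Strict because sin \<phi> > 0; it yields F > \<tau> - sin \<tau>.\<close>
      then have "(4 * (sin \<phi>)\<^sup>2 - 1) * sin \<tau> > - 1 * sin \<tau>"
        using assms by (intro mult_strict_right_mono) auto
      then show ?thesis
        using F sin_x_le_x[of \<tau>] \<tau> by linarith
    next
      case False
      have "(sin \<phi>)\<^sup>2 \<le> 1"
        by (simp add: abs_square_le_1)
      then have "\<bar>4 * (sin \<phi>)\<^sup>2 - 1\<bar> \<le> 3"
        using zero_le_power2[of "sin \<phi>"] by linarith
      then have "\<bar>(4 * (sin \<phi>)\<^sup>2 - 1) * sin \<tau>\<bar> \<le> 3 * 1"
        unfolding abs_mult by (intro mult_mono) auto
      then show ?thesis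
        using F False by linarith
    qed
  qed
  then have "r\<^sup>2 / 2 * F > 0"
    using r by simp
  then show ?thesis
    by (simp only: eq)
qed

section \<open>The complete trajectory through the reflection point\<close>

lemma join_at_0_line_helix:
  assumes "d > 0" "sin \<phi> > 0" "incoming d \<phi> \<gamma>" "continues_after_reflection \<gamma> L"
  shows "t \<le> 0 \<Longrightarrow> join_at_0 \<gamma> L t = line_lift d \<phi> t"
    and "t \<ge> 0 \<Longrightarrow> join_at_0 \<gamma> L t = helix d \<phi> t"
proof -
  have \<gamma>: "\<forall>t\<le>0. \<gamma> t = line_lift d \<phi> t" and L: "\<forall>t\<ge>0. L t = helix d \<phi> t"
    using assms by (simp_all add: incoming_iff continues_after_reflection_iff[OF assms(1-3)])
  show "join_at_0 \<gamma> L t = line_lift d \<phi> t" if "t \<le> 0"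
    \<comment> \<open>At t = 0 the joined curve takes the value of \<open>L\<close>; the line ends
      where the helix starts.\<close>
    using \<gamma> L that helix_0[of \<phi> d] assms(2) by (cases "t = 0") (simp_all add: join_at_0_def)
  show "join_at_0 \<gamma> L t = helix d \<phi> t" if "t \<ge> 0"
    using L that by (simp add: join_at_0_def)
qed

lemma billiard_trajectory_join:
  assumes d: "d > 0" "sin \<phi> > 0" and "cos \<phi> \<le> 0"
    and inc: "incoming d \<phi> \<gamma>" "continues_after_reflection \<gamma> L"
  shows "billiard_trajectory UNIV {0} (join_at_0 \<gamma> L)"
proof -
  let ?J = "join_at_0 \<gamma> L"
  note join = join_at_0_line_helix[OF d inc]
  have r: "radius d \<phi> \<noteq> 0"
    using d by (simp add: radius_def)
  have geo1: "geodesic {..0} ?J (\<lambda>t. vector [- cos \<phi>, - sin \<phi>, 0])"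
    using join by (intro geodesic_transform[OF geodesic_line_lift]) auto
  have geo2: "geodesic {0..} ?J (helix_momentum d \<phi>)"
    using join by (intro geodesic_transform[OF geodesic_helix[OF r]]) auto
  have "?J t \<in> table" for t
  proof (cases "t \<le> 0")
    case True
    then show ?thesis
      using d join by (simp add: table_def line_lift_def mult_nonneg_nonpos)
  next
    case False
    then show ?thesis
      using join helix_height_pos[OF assms(1-3), of t] by (simp add: table_def)
  qed
  moreover have "\<exists>p. geodesic J ?J p" if J: "is_interval J" "interior J \<inter> {0} = {}" for J
  proof -
    \<comment> \<open>An interval with points on both sides of 0 would contain 0 in its
      interior.\<close>
    have "J \<subseteq> {..0} \<or> J \<subseteq> {0..}"
    proof (rule ccontr)
      assume "\<not> ?thesis"
      then obtain s t where "s \<in> J" "s \<notin> {0..}" "t \<in> J" "t \<notin> {..0}"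
        by blast
      then have st: "s \<in> J" "t \<in> J" "s < 0" "0 < t"
        by auto
      then have "{s<..<t} \<subseteq> J"
        using mem_is_interval_1_I[OF J(1) st(1,2)] by (meson greaterThanLessThan_iff less_imp_le subsetI)
      then have "0 \<in> interior J"
        using st interior_maximal[of "{s<..<t}" J] by auto
      then show False
        using J by simp
    qed
    then show ?thesis
      using geo1 geo2 geodesic_subset by blast
  qed
  moreover have "\<exists>e>0. \<exists>p_in p_out. geodesic {0 - e..0} ?J p_in \<and> geodesic {0..0 + e} ?J p_out \<and>
        reflection (?J 0) (p_in 0) (p_out 0)"
  proof (intro exI conjI)
    \<comment> \<open>The choice e = 1 is arbitrary, as both halves are geodesics for all their
      times.\<close>
    show "(0::real) < 1" by simp
    show "geodesic {0 - 1..0} ?J (\<lambda>t. vector [- cos \<phi>, - sin \<phi>, 0])"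
      by (rule geodesic_subset[OF geo1]) auto
    show "geodesic {0..0 + 1} ?J (helix_momentum d \<phi>)"
      by (rule geodesic_subset[OF geo2]) auto
    show "reflection (?J 0) (vector [- cos \<phi>, - sin \<phi>, 0]) (helix_momentum d \<phi> 0)"
      using join(1)[of 0] helix_momentum_0[of d \<phi>] reflection_iff[OF d] d by simp
  qed
  ultimately show ?thesis
    unfolding billiard_trajectory_def by auto
qed

section \<open>Degeneration as the reflection point tends to the origin\<close>

lemma norm_vec3_le: "norm (v :: real ^ 3) \<le> \<bar>v $ 1\<bar> + \<bar>v $ 2\<bar> + \<bar>v $ 3\<bar>"
  using norm_le_l1_cart[of v] by (simp add: sum_3)

text \<open>The difference is (d, 0, -(d t sin \<phi>)/2), whose nonzero entries all carry the
  factor d.\<close>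

lemma norm_line_lift_diff_le:
  assumes "d > 0" "\<bar>t\<bar> \<le> B"
  shows "norm (line_lift d \<phi> t - (- t) *\<^sub>R vector [cos \<phi>, sin \<phi>, 0]) \<le> (1 + B) * d"
proof -
  have "\<bar>sin \<phi>\<bar> * \<bar>t\<bar> \<le> 1 * B"
    using assms by (intro mult_mono) auto
  then have "d * (\<bar>sin \<phi>\<bar> * \<bar>t\<bar>) \<le> d * B"
    using assms by (intro mult_left_mono) auto
  moreover have "0 \<le> d * (\<bar>sin \<phi>\<bar> * \<bar>t\<bar>)"
    using assms by simp
  moreover define v where "v = line_lift d \<phi> t - (- t) *\<^sub>R vector [cos \<phi>, sin \<phi>, 0]"
  then have "v $ 1 = d" "v $ 2 = 0" "v $ 3 = - (d * sin \<phi> / 2) * t"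
    by (simp_all add: line_lift_def)
  then have "norm v \<le> d + d * (\<bar>sin \<phi>\<bar> * \<bar>t\<bar>) / 2"
    using norm_vec3_le[of v] assms(1) by (simp add: abs_mult)
  ultimately have "norm v \<le> (1 + B) * d"
    by (simp add: algebra_simps)
  then show ?thesis
    by (simp only: v_def)
qed

text \<open>Center and radius are proportional to d, with \<open>\<rho>\<close> the radius for d =
  1. The time bound \<open>B\<close> enters only through the secular term r t / 2 of the
  height.\<close>

lemma norm_helix_le:
  assumes "0 < d" "d \<le> 1" "sin \<phi> > 0" "\<bar>t\<bar> \<le> B"
  defines "\<rho> \<equiv> 1 / (4 * sin \<phi>)"
  shows "norm (helix d \<phi> t) \<le> (3 / 4 + \<bar>cot \<phi>\<bar> / 4 + 2 * \<rho> + \<rho> / 2 * (B + 3 / 2 + \<bar>cot \<phi>\<bar> / 2)) * d"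
proof -
  define \<psi> where "\<psi> = pi / 2 - \<phi> + t / radius d \<phi>"
  have r: "radius d \<phi> = \<rho> * d" and \<rho>: "\<rho> > 0"
    using assms by (auto simp: radius_def \<rho>_def)
  have tri: "\<bar>a + s * u\<bar> \<le> \<bar>a\<bar> + s" if "\<bar>u\<bar> \<le> 1" "s \<ge> 0" for a s u :: real
    using abs_triangle_ineq[of a "s * u"] mult_left_mono[OF that] that by (simp add: abs_mult)
  have x: "\<bar>helix d \<phi> t $ 1\<bar> \<le> 3 / 4 * d + \<rho> * d"
    using tri[of "cos \<psi>" "\<rho> * d" "3 / 4 * d"] assms \<rho>
    by (simp add: helix_def Let_def center_def r \<psi>_def)
  have y: "\<bar>helix d \<phi> t $ 2\<bar> \<le> \<bar>cot \<phi>\<bar> / 4 * d + \<rho> * d"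
    using tri[of "sin \<psi>" "\<rho> * d" "- cot \<phi> * (d / 4)"] assms \<rho>
    by (simp add: helix_def Let_def center_def r \<psi>_def abs_mult)
  have "\<bar>sin \<psi> - cos \<phi>\<bar> \<le> 2" "\<bar>cos \<psi> - sin \<phi>\<bar> \<le> 2"
    using abs_sin_le_one[of \<psi>] abs_sin_le_one[of \<phi>] abs_cos_le_one[of \<psi>] abs_cos_le_one[of \<phi>]
    by linarith+
  \<comment> \<open>Here \<open>d \<le> 1\<close> gives a bound free of d; the decay of the height
    comes from its prefactor \<open>\<rho> / 2 * d\<close>.\<close>
  then have "d * \<bar>sin \<psi> - cos \<phi>\<bar> \<le> 1 * 2" "d * \<bar>cos \<psi> - sin \<phi>\<bar> \<le> 1 * 2"
    using assms(1,2) by (intro mult_mono; simp)+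
  then have "\<bar>3 * d / 4 * (sin \<psi> - cos \<phi>)\<bar> \<le> 3 / 2"
      "\<bar>cot \<phi> * (d / 4) * (cos \<psi> - sin \<phi>)\<bar> \<le> \<bar>cot \<phi>\<bar> / 2"
    using assms(1) mult_left_mono[of "d * \<bar>cos \<psi> - sin \<phi>\<bar>" 2 "\<bar>cot \<phi>\<bar>"]
    by (simp_all add: abs_mult mult.left_commute)
  moreover define W where "W = t + 3 * d / 4 * (sin \<psi> - cos \<phi>) + cot \<phi> * (d / 4) * (cos \<psi> - sin \<phi>)"
  ultimately have *: "\<bar>W\<bar> \<le> B + 3 / 2 + \<bar>cot \<phi>\<bar> / 2"
    using assms(4) by linarith
  have "helix d \<phi> t $ 3 = \<rho> / 2 * d * W"
    by (simp add: helix_def Let_def center_def r \<psi>_def W_def)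
  then have "\<bar>helix d \<phi> t $ 3\<bar> = \<rho> / 2 * d * \<bar>W\<bar>"
    using assms(1) \<rho> by (simp only: abs_mult)
  also have "\<dots> \<le> \<rho> / 2 * d * (B + 3 / 2 + \<bar>cot \<phi>\<bar> / 2)"
    using * assms(1) \<rho> by (intro mult_left_mono) auto
  finally have "\<bar>helix d \<phi> t $ 3\<bar> \<le> \<rho> / 2 * d * (B + 3 / 2 + \<bar>cot \<phi>\<bar> / 2)" .
  with x y norm_vec3_le[of "helix d \<phi> t"] show ?thesis
    by (simp add: algebra_simps)
qed

lemma uniform_limit_at_right_0I:
  fixes f :: "real \<Rightarrow> 'a \<Rightarrow> 'b :: real_normed_vector"
  assumes "\<And>d t. 0 < d \<Longrightarrow> d \<le> 1 \<Longrightarrow> t \<in> K \<Longrightarrow> norm (f d t - l t) \<le> C * d"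
  shows "uniform_limit K f l (at_right 0)"
proof (rule uniform_limitI)
  fix e :: real assume "e > 0"
  \<comment> \<open>\<open>\<bar>C\<bar> + 1\<close> keeps the denominator positive whatever the
    sign of \<open>C\<close>.\<close>
  define \<delta> where "\<delta> = min 1 (e / (\<bar>C\<bar> + 1))"
  have \<delta>: "\<delta> > 0"
    using \<open>e > 0\<close> by (auto simp: \<delta>_def)
  have "\<forall>t\<in>K. dist (f d t) (l t) < e" if "0 < d" "d < \<delta>" for d
  proof
    fix t assume "t \<in> K"
    with that have "dist (f d t) (l t) \<le> C * d"
      using assms by (simp add: dist_norm \<delta>_def)
    also have "\<dots> \<le> \<bar>C\<bar> * d"
      using that by (intro mult_right_mono) auto
    also have "\<dots> < (\<bar>C\<bar> + 1) * d"
      using that by (intro mult_strict_right_mono) auto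
    also have "\<dots> < e"
      using that by (simp add: \<delta>_def field_simps)
    finally show "dist (f d t) (l t) < e" .
  qed
  then show "\<forall>\<^sub>F d in at_right 0. \<forall>t\<in>K. dist (f d t) (l t) < e"
    using \<delta> unfolding eventually_at_right_field by blast
qed

text \<open>For fixed \<phi> and a bounded set of times, each half differs from its limit by at most
  a constant times d; the larger of the two constants serves both.\<close>

lemma billiard_limit:
  assumes "sin \<phi> > 0"
    and tr: "\<forall>d>0. incoming d \<phi> (\<gamma> d) \<and> continues_after_reflection (\<gamma> d) (L d)"
  shows "C0_loc_limit UNIV (\<lambda>d. join_at_0 (\<gamma> d) (L d))
             (\<lambda>t. if t \<le> 0 then (- t) *\<^sub>R vector [cos \<phi>, sin \<phi>, 0] else 0) (at_right 0)"
  unfolding C0_loc_limit_def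
proof (intro allI impI)
  fix K :: "real set" assume "compact K \<and> K \<subseteq> UNIV"
  then obtain B where B: "\<forall>t\<in>K. \<bar>t\<bar> \<le> B"
    using compact_imp_bounded bounded_real by blast
  define C where "C = (3 / 4 + \<bar>cot \<phi>\<bar> / 4 + 2 * (1 / (4 * sin \<phi>))
    + 1 / (4 * sin \<phi>) / 2 * (B + 3 / 2 + \<bar>cot \<phi>\<bar> / 2))"
  show "uniform_limit K (\<lambda>d. join_at_0 (\<gamma> d) (L d))
     (\<lambda>t. if t \<le> 0 then (- t) *\<^sub>R vector [cos \<phi>, sin \<phi>, 0] else 0) (at_right 0)"
  proof (rule uniform_limit_at_right_0I[where C = "max (1 + B) C"])
    fix d t :: real assume d: "0 < d" "d \<le> 1" "t \<in> K"
    have "incoming d \<phi> (\<gamma> d)" "continues_after_reflection (\<gamma> d) (L d)"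
      using tr d by auto
    note join = join_at_0_line_helix[OF d(1) assms(1) this, of t]
    let ?D = "join_at_0 (\<gamma> d) (L d) t - (if t \<le> 0 then (- t) *\<^sub>R vector [cos \<phi>, sin \<phi>, 0] else 0)"
    have tB: "\<bar>t\<bar> \<le> B"
      using B d by blast
    have "norm ?D \<le> (1 + B) * d \<or> norm ?D \<le> C * d"
    proof (cases "t \<le> 0")
      case True
      then show ?thesis
        using join(1) norm_line_lift_diff_le[OF d(1) tB, of \<phi>] by simp
    next
      case False
      then show ?thesis
        using join(2) norm_helix_le[OF d(1,2) assms(1) tB] by (simp add: C_def)
    qed
    then show "norm ?D \<le> max (1 + B) C * d"
      using mult_right_mono[of "1 + B" "max (1 + B) C" d] mult_right_mono[of C "max (1 + B) C" d] d(1)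
      by linarith
  qed
qed

lemma C0_loc_limit_transform:
  assumes "C0_loc_limit I f l F" "J \<subseteq> I"
    and "\<forall>\<^sub>F d in F. \<forall>t\<in>J. f d t = f' d t" "\<And>t. t \<in> J \<Longrightarrow> l t = l' t"
  shows "C0_loc_limit J f' l' F"
  unfolding C0_loc_limit_def
proof (intro allI impI)
  fix K :: "real set" assume K: "compact K \<and> K \<subseteq> J"
  then have "uniform_limit K f l F"
    using assms unfolding C0_loc_limit_def by blast
  moreover have "\<forall>\<^sub>F d in F. \<forall>t\<in>K. f d t = f' d t"
    using assms(3) by eventually_elim (use K in auto)
  ultimately show "uniform_limit K f' l' F"
    using K assms(4) uniform_limit_cong[of K f f' F l l'] by blast
qed

theorem proposition5p29:
  shows
    "(\<forall>d>0. \<forall>\<phi>\<in>{0<..<pi}.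
        (\<exists>\<gamma>. incoming d \<phi> \<gamma>) \<and>
        (\<forall>\<gamma> \<gamma>'. incoming d \<phi> \<gamma> \<and> incoming d \<phi> \<gamma>' \<longrightarrow> (\<forall>t\<le>0. \<gamma> t = \<gamma>' t)) \<and>
        (\<forall>\<gamma>. incoming d \<phi> \<gamma> \<longrightarrow>
           (\<exists>L. continues_after_reflection \<gamma> L) \<and>
           (\<forall>L L'. continues_after_reflection \<gamma> L \<and> continues_after_reflection \<gamma> L' \<longrightarrow>
              (\<forall>t\<ge>0. L t = L' t)) \<and>
           (\<forall>L. continues_after_reflection \<gamma> L \<longrightarrow>
              (\<exists>\<theta>. horizontal_lift {0..} (circular_path (center d \<phi>) (radius d \<phi>) \<theta>) L))))
     \<and>
     (\<exists>U. U \<subseteq> {0<..<pi} \<and> (\<forall>\<^sub>F \<phi> in at_left pi. \<phi> \<in> U) \<and>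
        (\<forall>\<phi>\<in>U. \<forall>d>0. \<forall>\<gamma> L. incoming d \<phi> \<gamma> \<and> continues_after_reflection \<gamma> L \<longrightarrow>
           (\<forall>t>0. L t \<notin> wall) \<and>
           proj ` L ` {0..} = sphere (center d \<phi>) (radius d \<phi>) \<and>
           billiard_trajectory UNIV {0} (join_at_0 \<gamma> L)) \<and>
        (\<forall>\<phi>\<in>U. \<forall>\<gamma> L.
           (\<forall>d>0. incoming d \<phi> (\<gamma> d) \<and> continues_after_reflection (\<gamma> d) (L d)) \<longrightarrow>
           C0_loc_limit {0..} L (\<lambda>t. 0) (at_right 0) \<and>
           C0_loc_limit UNIV (\<lambda>d. join_at_0 (\<gamma> d) (L d))
             (\<lambda>t. if t \<le> 0 then (- t) *\<^sub>R vector [cos \<phi>, sin \<phi>, 0] else 0) (at_right 0)) \<and>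
        {1.584..<pi} \<subseteq> U)"
proof (intro conjI ballI allI impI)
  fix d \<phi> :: real assume "d > 0" "\<phi> \<in> {0<..<pi}"
  then have d: "d > 0" "sin \<phi> > 0"
    by (auto intro: sin_gt_zero)
  show "\<exists>\<gamma>. incoming d \<phi> \<gamma>"
    unfolding incoming_iff by blast
  show "\<gamma> t = \<gamma>' t" if "incoming d \<phi> \<gamma> \<and> incoming d \<phi> \<gamma>'" "t \<le> 0" for \<gamma> \<gamma>' t
    using that by (simp add: incoming_iff)
  fix \<gamma> assume "incoming d \<phi> \<gamma>"
  note L_iff = continues_after_reflection_iff[OF d this]
  show "\<exists>L. continues_after_reflection \<gamma> L"
    unfolding L_iff by blast
  show "L t = L' t" if "continues_after_reflection \<gamma> L \<and> continues_after_reflection \<gamma> L'" "t \<ge> 0"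
    for L L' t
    using that by (simp add: L_iff)
  show "\<exists>\<theta>. horizontal_lift {0..} (circular_path (center d \<phi>) (radius d \<phi>) \<theta>) L"
    if L: "continues_after_reflection \<gamma> L" for L
  proof -
    obtain p where "geodesic {0..} L p"
      using L unfolding continues_after_reflection_def by blast
    \<comment> \<open>The angle \<open>\<theta>\<close> is pi/2 - \<phi>, supplied by
      \<open>proj_helix\<close>.\<close>
    then show ?thesis
      using L geodesic_imp_horizontal_lift[of "{0..}" L p] by (auto simp: L_iff proj_helix)
  qed
next
  \<comment> \<open>On this interval sin \<phi> > 0 and cos \<phi> \<le> 0, the two signs behind the
    positivity of the height.\<close>
  let ?U = "{pi / 2..<pi}"
  have U: "sin \<phi> > 0" "cos \<phi> \<le> 0" if "\<phi> \<in> ?U" for \<phi>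
  proof -
    show "sin \<phi> > 0"
      using that pi_gt_zero by (intro sin_gt_zero) auto
    show "cos \<phi> \<le> 0"
      using that cos_monotone_0_pi_le[of "pi / 2" \<phi>] by auto
  qed
  show "\<exists>U\<subseteq>{0<..<pi}. (\<forall>\<^sub>F \<phi> in at_left pi. \<phi> \<in> U) \<and>
        (\<forall>\<phi>\<in>U. \<forall>d>0. \<forall>\<gamma> L. incoming d \<phi> \<gamma> \<and> continues_after_reflection \<gamma> L \<longrightarrow>
           (\<forall>t>0. L t \<notin> wall) \<and>
           proj ` L ` {0..} = sphere (center d \<phi>) (radius d \<phi>) \<and>
           billiard_trajectory UNIV {0} (join_at_0 \<gamma> L)) \<and>
        (\<forall>\<phi>\<in>U. \<forall>\<gamma> L.
           (\<forall>d>0. incoming d \<phi> (\<gamma> d) \<and> continues_after_reflection (\<gamma> d) (L d)) \<longrightarrow>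
           C0_loc_limit {0..} L (\<lambda>t. 0) (at_right 0) \<and>
           C0_loc_limit UNIV (\<lambda>d. join_at_0 (\<gamma> d) (L d))
             (\<lambda>t. if t \<le> 0 then (- t) *\<^sub>R vector [cos \<phi>, sin \<phi>, 0] else 0) (at_right 0)) \<and>
        {1.584..<pi} \<subseteq> U"
  proof (intro exI[of _ ?U] conjI ballI allI impI; (elim conjE)?)
    show "?U \<subseteq> {0<..<pi}"
      using pi_gt_zero by auto
    show "\<forall>\<^sub>F \<phi> in at_left pi. \<phi> \<in> ?U"
      unfolding eventually_at_left_field using pi_gt_zero by (intro exI[of _ "pi / 2"]) auto
    \<comment> \<open>It suffices that pi < 3.168.\<close>
    show "{1.584..<pi} \<subseteq> ?U"
      using pi_approx(2) by auto
  next
    fix \<phi> d :: real and \<gamma> L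
    assume \<phi>: "\<phi> \<in> ?U" and d: "d > 0" and inc: "incoming d \<phi> \<gamma>" "continues_after_reflection \<gamma> L"
    have L: "\<forall>t\<ge>0. L t = helix d \<phi> t"
      using continues_after_reflection_iff[OF d U(1)[OF \<phi>] inc(1)] inc(2) by blast
    show "L t \<notin> wall" if "t > 0" for t
      using L helix_height_pos[OF d U[OF \<phi>] that] that by (simp add: wall_def)
    have "proj ` L ` {0..} = circular_path (center d \<phi>) (radius d \<phi>) (pi / 2 - \<phi>) ` {0..}"
      using L by (simp add: image_image proj_helix)
    then show "proj ` L ` {0..} = sphere (center d \<phi>) (radius d \<phi>)"
      using circular_path_image[of "radius d \<phi>"] d U(1)[OF \<phi>] by (simp add: radius_def)
    show "billiard_trajectory UNIV {0} (join_at_0 \<gamma> L)"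
      by (rule billiard_trajectory_join[OF d U[OF \<phi>] inc])
  next
    fix \<phi> and \<gamma> L :: "real \<Rightarrow> real \<Rightarrow> real ^ 3"
    assume \<phi>: "\<phi> \<in> ?U"
      and tr: "\<forall>d>0. incoming d \<phi> (\<gamma> d) \<and> continues_after_reflection (\<gamma> d) (L d)"
    show lim: "C0_loc_limit UNIV (\<lambda>d. join_at_0 (\<gamma> d) (L d))
             (\<lambda>t. if t \<le> 0 then (- t) *\<^sub>R vector [cos \<phi>, sin \<phi>, 0] else 0) (at_right 0)"
      by (rule billiard_limit[OF U(1)[OF \<phi>] tr])
    \<comment> \<open>On t \<ge> 0 the joined curve is \<open>L\<close>, and the limit is 0 there,
      also at t = 0, where the half-line ends at the origin.\<close>
    show "C0_loc_limit {0..} L (\<lambda>t. 0) (at_right 0)"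
      by (rule C0_loc_limit_transform[OF lim]) (auto simp: join_at_0_def)
  qed
qed

end
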